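(* Let $\Gamma$ be a simple graph on $V=\{1,\dots,n\}$ with edge ideal $I\subseteq k[x_1,\dots,x_n]$ and let $t\ge 2$ be an integer. Let $F$ be a cover of $\Gamma$ which is minimal among the covers containing $N[U]$ for a set $U\subseteq V$ such that there exists a strongly $t$-saturating weighted graph on $U$, that is, such that there exists $\mathbf a\in\mathbb N^n$ with $V_{\mathbf a}=U$ for which the weighted graph $\Gamma_{\mathbf a}$ is strongly $t$-saturating. Then $P_F$ is an embedded associated prime of $I^t$.
   Context: $k$ is a field, and $\mathbb N$ contains $0$. The edge ideal of $\Gamma$ is the ideal generated by the monomials $x_ix_j$ with $\{i,j\}$ an edge of $\Gamma$. A cover of $\Gamma$ is a set of vertices meeting every edge. For $F\subseteq V$, $P_F$ is the ideal generated by the variables $x_i$, $i\in F$. Embedded associated prime means non-minimal associated prime. For $U\subseteq V$, $N[U]$ is the union of $U$ and the set of vertices adjacent to some vertex of $U$ (closed neighborhood). "$F$ is minimal among the covers containing $N$" means that $F$ is a cover containing $N$ and no proper subset of $F$ is a cover containing $N$. A weighted graph is a simple graph (its base graph) whose vertices are assigned positive integers, called weights. A matching of a weighted graph $\Omega$ is a family of edges (not necessarily different) such that every vertex of $\Omega$ appears in these edges no more times than its weight. The matching number $\nu(\Omega)$ is the maximal number of edges (counted with multiplicity) of a matching of $\Omega$. For a vertex $j$, $\Omega-j$ is the induced weighted subgraph on the vertices different from $j$. A weighted graph $\Omega$ is strongly $t$-saturating if $\nu(\Omega)<t$ and $\nu(\Omega-j)\ge t-a_j$ for all vertices $j$ of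 $\Omega$, where $a_j$ is the weight of $j$. For $\mathbf a\in\mathbb N^n$, $V_{\mathbf a}=\{i\in V\mid a_i>0\}$, and $\Gamma_{\mathbf a}$ is the weighted graph whose base graph is the subgraph of $\Gamma$ induced on $V_{\mathbf a}$ and where $i\in V_{\mathbf a}$ has weight $a_i$.
   Formalization: The formal theorem additionally assumes that U is nonempty and that the subgraph of Γ induced on U has no isolated vertex; without these the claim fails, e.g. for U empty, or for Γ a single edge {1,2} with a = (t,0). *)

theory Defs
  imports
    "HOL-Library.Poly_Mapping"
    "HOL-Library.Multiset"
    "HOL-Algebra.Ideal_Product"
    "HOL-Algebra.Algebraic_Closure_Type"
begin

section \<open>Simple graphs and covers\<close>

text \<open>
  The vertex set \<open>{1, \<dots>, n}\<close> is rendered as an arbitrary finite type \<open>'v\<close>; a simple graph on it is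
  given by its set of edges, an edge being a set of two vertices.
\<close>

definition simple_graph :: "'v set set \<Rightarrow> bool" where
  "simple_graph E \<longleftrightarrow> (\<forall>e\<in>E. card e = 2)"

definition graph_cover :: "'v set set \<Rightarrow> 'v set \<Rightarrow> bool" where
  "graph_cover E C \<longleftrightarrow> (\<forall>e\<in>E. e \<inter> C \<noteq> {})"

definition closed_nbhd :: "'v set set \<Rightarrow> 'v set \<Rightarrow> 'v set" where
  "closed_nbhd E U = U \<union> {j. \<exists>i\<in>U. {i, j} \<in> E}"

definition minimal_cover_containing :: "'v set set \<Rightarrow> 'v set \<Rightarrow> 'v set \<Rightarrow> bool" where
  "minimal_cover_containing E N F \<longleftrightarrow>
     graph_cover E F \<and> N \<subseteq> F \<and> (\<forall>F'. F' \<subset> F \<longrightarrow> \<not> (graph_cover E F' \<and> N \<subseteq> F'))"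


section \<open>Weighted graphs and matchings\<close>

record 'v wgraph =
  wverts :: "'v set"
  wedges :: "'v set set"
  weight :: "'v \<Rightarrow> nat"

definition weighted_graph :: "'v wgraph \<Rightarrow> bool" where
  "weighted_graph W \<longleftrightarrow> finite (wverts W) \<and>
     (\<forall>e\<in>wedges W. e \<subseteq> wverts W \<and> card e = 2) \<and> (\<forall>v\<in>wverts W. weight W v > 0)"

definition wmatching :: "'v wgraph \<Rightarrow> 'v set multiset \<Rightarrow> bool" where
  "wmatching W M \<longleftrightarrow> set_mset M \<subseteq> wedges W \<and>
     (\<forall>v\<in>wverts W. size {#e \<in># M. v \<in> e#} \<le> weight W v)"

definition matching_number :: "'v wgraph \<Rightarrow> nat" where
  "matching_number W = Max {size M | M. wmatching W M}"

definition delete_vertex :: "'v wgraph \<Rightarrow> 'v \<Rightarrow> 'v wgraph" where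
  "delete_vertex W j =
     \<lparr>wverts = wverts W - {j}, wedges = {e \<in> wedges W. j \<notin> e}, weight = weight W\<rparr>"

text \<open>The subtraction \<open>t - a\<^sub>j\<close> takes place in the integers.\<close>

definition strongly_saturating :: "nat \<Rightarrow> 'v wgraph \<Rightarrow> bool" where
  "strongly_saturating t W \<longleftrightarrow> matching_number W < t \<and>
     (\<forall>j\<in>wverts W. int (matching_number (delete_vertex W j)) \<ge> int t - int (weight W j))"

text \<open>
  The graph without vertices is strongly \<open>t\<close>-saturating, and so is a single vertex of weight \<open>t\<close>.
  The result on embedded primes is false for both: for \<open>E = {{1, 2}}\<close> and \<open>a = (t, 0)\<close> it would make
  \<open>(x\<^sub>1, x\<^sub>2)\<close> an associated prime of \<open>(x\<^sub>1 x\<^sub>2)\<^sup>t\<close>. It therefore has to be stated for graphs on a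
  non-empty \<open>U\<close> without isolated vertices, as explicit hypotheses on \<open>U\<close>.
\<close>

definition vec_support :: "('v \<Rightarrow> nat) \<Rightarrow> 'v set" where
  "vec_support a = {i. a i > 0}"

definition induced_wgraph :: "'v set set \<Rightarrow> ('v \<Rightarrow> nat) \<Rightarrow> 'v wgraph" where
  "induced_wgraph E a =
     \<lparr>wverts = vec_support a, wedges = {e \<in> E. e \<subseteq> vec_support a}, weight = a\<rparr>"

lemma weighted_graph_induced:
  fixes E :: "'v::finite set set"
  shows "simple_graph E \<Longrightarrow> weighted_graph (induced_wgraph E a)"
  by (simp add: weighted_graph_def induced_wgraph_def simple_graph_def vec_support_def)

lemma weighted_graph_delete: "weighted_graph W \<Longrightarrow> weighted_graph (delete_vertex W j)"
  by (simp add: weighted_graph_def delete_vertex_def subset_Diff_insert)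

text \<open>The maximum in the matching number is over a finite non-empty set.\<close>

lemma wmatching_sizes:
  assumes "weighted_graph W"
  shows "finite {size M | M. wmatching W M}" and "{size M | M. wmatching W M} \<noteq> {}"
proof -
  have fin: "finite (wverts W)" using assms by (simp add: weighted_graph_def)
  have e: "\<exists>u. u \<in> e \<and> u \<in> wverts W" if "e \<in> wedges W" for e
  proof -
    have "e \<subseteq> wverts W" "card e = 2" using assms that by (simp_all add: weighted_graph_def)
    moreover from this have "e \<noteq> {}" by (metis card.empty zero_neq_numeral)
    ultimately show ?thesis by blast
  qed
  have le: "size M \<le> (\<Sum>v\<in>wverts W. size {#e \<in># M. v \<in> e#})"
    if "set_mset M \<subseteq> wedges W" for M
    using that
  proof (induction M)
    case (add x M)
    obtain u where u: "u \<in> x" "u \<in> wverts W" using e[of x] add.prems by auto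
    let ?s = "\<lambda>M. \<Sum>v\<in>wverts W. size {#e \<in># M. v \<in> e#}"
    have "?s (add_mset x M) = (\<Sum>v\<in>wverts W. of_bool (v \<in> x) + size {#e \<in># M. v \<in> e#})"
      by (intro sum.cong) simp_all
    then have 1: "?s (add_mset x M) = (\<Sum>v\<in>wverts W. of_bool (v \<in> x)) + ?s M"
      by (simp only: sum.distrib)
    have 2: "(\<Sum>v\<in>wverts W. of_bool (v \<in> x)) \<ge> (1 :: nat)"
      using member_le_sum[of u "wverts W" "\<lambda>v. of_bool (v \<in> x) :: nat"] u fin by simp
    have "size M \<le> ?s M" using add by simp
    with 1 2 show ?case by simp
  qed simp
  have "size M \<le> (\<Sum>v\<in>wverts W. weight W v)" if "wmatching W M" for M
  proof -
    have "size M \<le> (\<Sum>v\<in>wverts W. size {#e \<in># M. v \<in> e#})"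
      using that by (intro le) (simp add: wmatching_def)
    also have "\<dots> \<le> (\<Sum>v\<in>wverts W. weight W v)"
      using that by (intro sum_mono) (simp add: wmatching_def)
    finally show ?thesis .
  qed
  then have "{size M | M. wmatching W M} \<subseteq> {..\<Sum>v\<in>wverts W. weight W v}" by blast
  then show "finite {size M | M. wmatching W M}" by (rule finite_subset) simp
  have "wmatching W {#}" by (simp add: wmatching_def)
  then show "{size M | M. wmatching W M} \<noteq> {}" by blast
qed


section \<open>The polynomial ring and its ideals\<close>

text \<open>
  A monomial is an exponent vector of type \<open>'v \<Rightarrow>\<^sub>0 nat\<close>, and a polynomial a finitely supported
  family of coefficients indexed by monomials, with convolution as product.
\<close>

type_synonym ('v, 'k) mpolynomial = "('v \<Rightarrow>\<^sub>0 nat) \<Rightarrow>\<^sub>0 'k"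

abbreviation mpoly_ring :: "('v, 'k::field) mpolynomial ring" where
  "mpoly_ring \<equiv> ring_of_type_algebra"

definition pvar :: "'v \<Rightarrow> ('v, 'k::field) mpolynomial" where
  "pvar i = Poly_Mapping.single (Poly_Mapping.single i 1) 1"

definition edge_ideal :: "'v set set \<Rightarrow> ('v, 'k::field) mpolynomial set" where
  "edge_ideal E = genideal mpoly_ring {pvar i * pvar j | i j. {i, j} \<in> E}"

definition variable_ideal :: "'v set \<Rightarrow> ('v, 'k::field) mpolynomial set" where
  "variable_ideal F = genideal mpoly_ring (pvar ` F)"

text \<open>The monoid of ideals has the ideal product as its multiplication.\<close>

definition ideal_power :: "('a, 'b) ring_scheme \<Rightarrow> 'a set \<Rightarrow> nat \<Rightarrow> 'a set" where
  "ideal_power R I t = I [^]\<^bsub>ideals_set R\<^esub> t"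

text \<open>
  An associated prime of \<open>I\<close> is one of the module \<open>R/I\<close>, that is, a prime ideal which is the
  annihilator of the residue class of some \<open>f\<close>.
\<close>

definition associated_prime :: "('a, 'b) ring_scheme \<Rightarrow> 'a set \<Rightarrow> 'a set \<Rightarrow> bool" where
  "associated_prime R I P \<longleftrightarrow>
     primeideal P R \<and> (\<exists>f\<in>carrier R. P = {r \<in> carrier R. r \<otimes>\<^bsub>R\<^esub> f \<in> I})"

definition embedded_associated_prime :: "('a, 'b) ring_scheme \<Rightarrow> 'a set \<Rightarrow> 'a set \<Rightarrow> bool" where
  "embedded_associated_prime R I P \<longleftrightarrow>
     associated_prime R I P \<and> (\<exists>Q. associated_prime R I Q \<and> Q \<subset> P)"

end

theory Submission
  imports Defs
begin

text \<open>
  The power \<open>I\<^sup>t\<close> is the span of the monomials divisible by a product of \<open>t\<close> edges. Localize at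
  \<open>P\<^sub>F\<close>, so that the variables outside \<open>F\<close> become units. If \<open>x\<^sup>a\<close> were in the localized \<open>I\<^sup>t\<close>, all
  \<open>t\<close> edges dividing it would lie in \<open>U\<close>, because they meet \<open>F\<close> and \<open>N[U] \<subseteq> F\<close>; they would form a
  matching of \<open>\<Gamma>\<^sub>a\<close> of size \<open>t\<close>. On the other hand a power of each variable \<open>x\<^sub>i\<close> with \<open>i \<in> F\<close>
  multiplies \<open>x\<^sup>a\<close> into it: if \<open>i\<close> is adjacent to \<open>j \<in> U\<close>, add \<open>a\<^sub>j\<close> copies of the edge \<open>{i, j}\<close> to a
  maximum matching of \<open>\<Gamma>\<^sub>a - j\<close>; otherwise, by minimality, \<open>i\<close> has a neighbour outside \<open>F\<close>, and \<open>x\<^sub>i\<close>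
  lies in the localized \<open>I\<close>. Hence some monomial multiple of \<open>x\<^sup>a\<close> has annihilator \<open>P\<^sub>F\<close>. The same
  argument with \<open>a = 0\<close> shows that \<open>P\<^sub>C\<close> is associated for every minimal cover \<open>C\<close>, and \<open>F\<close>
  properly contains one, since a vertex of \<open>U\<close> can be removed from \<open>F\<close>.
\<close>

section \<open>Monomial ideals\<close>

abbreviation monomial :: "'m \<Rightarrow> 'm \<Rightarrow>\<^sub>0 'k::field" where
  "monomial m \<equiv> Poly_Mapping.single m 1"

text \<open>\<open>S\<close> lists every exponent allowed, not just those of generators. The span is
  an ideal once \<open>S\<close> is \<open>add_closed\<close>.\<close>

definition monomial_ideal :: "'m set \<Rightarrow> ('m \<Rightarrow>\<^sub>0 'k::field) set" where
  "monomial_ideal S = {p. Poly_Mapping.keys p \<subseteq> S}"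

definition add_closed :: "'m::comm_monoid_add set \<Rightarrow> bool" where
  "add_closed S \<longleftrightarrow> (\<forall>m\<in>S. \<forall>k. m + k \<in> S)"

lemma ring_of_type_algebra_simps [simp]:
  "carrier ring_of_type_algebra = UNIV"
  "x \<otimes>\<^bsub>ring_of_type_algebra\<^esub> y = x * y"
  "x \<oplus>\<^bsub>ring_of_type_algebra\<^esub> y = x + y"
  "\<zero>\<^bsub>ring_of_type_algebra\<^esub> = 0"
  "\<one>\<^bsub>ring_of_type_algebra\<^esub> = 1"
  by (simp_all add: ring_of_type_algebra_def)

lemma sum_single_lookup:
  "(\<Sum>m\<in>Poly_Mapping.keys p. Poly_Mapping.single m (Poly_Mapping.lookup p m)) = p"
  by (rule poly_mapping_eqI)
    (auto simp: lookup_sum lookup_single when_def in_keys_iff sum.delta' intro: sum.neutral)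

text \<open>A finite sum over pairs from the supports, from which a coefficient fed by a single pair
  can be read off.\<close>

lemma lookup_mult_sum:
  fixes p q :: "'m::comm_monoid_add \<Rightarrow>\<^sub>0 'k::field"
  shows "Poly_Mapping.lookup (p * q) m =
    (\<Sum>(a, b)\<in>Poly_Mapping.keys p \<times> Poly_Mapping.keys q.
       (Poly_Mapping.lookup p a * Poly_Mapping.lookup q b when a + b = m))"
proof -
  have "p * q = (\<Sum>(a, b)\<in>Poly_Mapping.keys p \<times> Poly_Mapping.keys q.
      Poly_Mapping.single (a + b) (Poly_Mapping.lookup p a * Poly_Mapping.lookup q b))"
    by (subst (1) sum_single_lookup[of p, symmetric], subst (1) sum_single_lookup[of q, symmetric])
      (simp add: sum_product sum.cartesian_product mult_single)
  then show ?thesis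
    by (simp add: lookup_sum lookup_single case_prod_unfold)
qed

lemma monomial_ideal_subset:
  assumes "0 \<in> A" "\<And>p q. p \<in> A \<Longrightarrow> q \<in> A \<Longrightarrow> p + q \<in> A"
    and "\<And>m c. m \<in> S \<Longrightarrow> Poly_Mapping.single m c \<in> A"
  shows "monomial_ideal S \<subseteq> A"
proof
  fix p :: "'a \<Rightarrow>\<^sub>0 'b"
  assume "p \<in> monomial_ideal S"
  then have sub: "Poly_Mapping.keys p \<subseteq> S" by (simp add: monomial_ideal_def)
  have "(\<Sum>m\<in>K. Poly_Mapping.single m (Poly_Mapping.lookup p m)) \<in> A"
    if "finite K" "K \<subseteq> S" for K
    using that by induction (use assms in auto)
  from this[OF finite_keys sub] show "p \<in> A" by (simp add: sum_single_lookup)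
qed

lemma single_in_monomial_ideal: "m \<in> S \<Longrightarrow> Poly_Mapping.single m c \<in> monomial_ideal S"
  by (simp add: monomial_ideal_def)

lemma monomial_ideal_add:
  "p \<in> monomial_ideal S \<Longrightarrow> q \<in> monomial_ideal S \<Longrightarrow> p + q \<in> monomial_ideal S"
  using keys_add[of p q] by (auto simp: monomial_ideal_def)

lemma monomial_ideal_mult:
  fixes p q :: "'m::comm_monoid_add \<Rightarrow>\<^sub>0 'k::field"
  assumes "p \<in> monomial_ideal S" "add_closed S"
  shows "p * q \<in> monomial_ideal S"
  using assms keys_mult[of p q] by (fastforce simp: monomial_ideal_def add_closed_def)

lemma ideal_monomial_ideal:
  assumes "add_closed S"
  shows "ideal (monomial_ideal S) (ring_of_type_algebra :: ('m::comm_monoid_add \<Rightarrow>\<^sub>0 'k::field) ring)"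
    (is "ideal ?I ?R")
proof -
  interpret cring ?R by (rule cring_from_type_algebra)
  have minus: "\<ominus>\<^bsub>?R\<^esub> p = - p" for p :: "'m \<Rightarrow>\<^sub>0 'k"
    using minus_equality[of "- p" p] by simp
  show ?thesis
  proof (rule idealI)
    show "subgroup ?I (add_monoid ?R)"
    proof (rule add.subgroupI)
      show "?I \<noteq> {}" by (auto simp: monomial_ideal_def intro: exI[of _ 0])
      show "\<ominus>\<^bsub>?R\<^esub> p \<in> ?I" if "p \<in> ?I" for p
        using monomial_ideal_mult[OF that assms, of "- 1"] by (simp add: minus)
    qed (simp_all add: monomial_ideal_add)
  qed (auto simp: monomial_ideal_mult[OF _ assms] mult.commute[of _ "_ :: 'm \<Rightarrow>\<^sub>0 'k"] intro: ring_axioms)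
qed

text \<open>The multiples of the generators form an \<open>add_closed\<close> set of exponents, so
  their span is an ideal. Conversely \<open>c x^(g+k)\<close> is the generator \<open>x^g\<close>
  times \<open>c x^k\<close>.\<close>

lemma genideal_monomials:
  fixes G :: "'m::comm_monoid_add set"
  shows "genideal ring_of_type_algebra (monomial ` G) =
    (monomial_ideal {g + k |g k. g \<in> G} :: ('m \<Rightarrow>\<^sub>0 'k::field) set)"
    (is "genideal ?R _ = ?I")
proof
  interpret cring ?R by (rule cring_from_type_algebra)
  have up: "add_closed {g + k |g k. g \<in> G}"
    by (fastforce simp: add_closed_def add.assoc)
  have "monomial ` G \<subseteq> ?I"
    by (auto intro!: single_in_monomial_ideal) (metis add.right_neutral)
  then show "genideal ?R (monomial ` G) \<subseteq> ?I"
    by (intro genideal_minimal ideal_monomial_ideal up)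
  interpret J: ideal "genideal ?R (monomial ` G)" ?R
    by (rule genideal_ideal) simp
  show "?I \<subseteq> genideal ?R (monomial ` G)"
  proof (rule monomial_ideal_subset)
    fix m and c :: 'k
    assume "m \<in> {g + k |g k. g \<in> G}"
    then obtain g k where m: "m = g + k" "g \<in> G" by blast
    then have "monomial g \<in> genideal ?R (monomial ` G)"
      using genideal_self'[of "monomial g"] genideal_self[of "monomial ` G"] by auto
    from J.I_r_closed[OF this, of "Poly_Mapping.single k c"]
    show "Poly_Mapping.single m c \<in> genideal ?R (monomial ` G)"
      by (simp add: m mult_single)
  qed (use J.zero_closed J.a_closed in auto)
qed

lemma ideal_prod_monomial:
  fixes S T :: "'m::comm_monoid_add set"
  shows "ideal_prod ring_of_type_algebra (monomial_ideal S) (monomial_ideal T) =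
    (monomial_ideal {s + t |s t. s \<in> S \<and> t \<in> T} :: ('m \<Rightarrow>\<^sub>0 'k::field) set)"
    (is "ideal_prod ?R ?I ?J = ?K")
proof
  show "ideal_prod ?R ?I ?J \<subseteq> ?K"
  proof
    fix p assume "p \<in> ideal_prod ?R ?I ?J"
    then show "p \<in> ?K"
    proof induction
      case (prod p q)
      then show ?case
        using keys_mult[of p q] by (simp add: monomial_ideal_def) blast
    qed (simp add: monomial_ideal_add)
  qed
  show "?K \<subseteq> ideal_prod ?R ?I ?J"
  proof (rule monomial_ideal_subset)
    show "0 \<in> ideal_prod ?R ?I ?J"
      using ideal_prod.prod[of 0 ?I 0 ?J ?R] by (simp add: monomial_ideal_def)
    show "p + q \<in> ideal_prod ?R ?I ?J"
      if "p \<in> ideal_prod ?R ?I ?J" "q \<in> ideal_prod ?R ?I ?J" for p q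
      using ideal_prod.sum[OF that] by simp
    fix m and c :: 'k
    assume "m \<in> {s + t |s t. s \<in> S \<and> t \<in> T}"
    then obtain s t where "m = s + t" "s \<in> S" "t \<in> T" by blast
    then show "Poly_Mapping.single m c \<in> ideal_prod ?R ?I ?J"
      using ideal_prod.prod[of "monomial s" ?I "Poly_Mapping.single t c" ?J ?R]
      by (simp add: single_in_monomial_ideal mult_single)
  qed
qed

text \<open>Cancellation makes adding \<open>g\<close> injective, so terms cannot merge.
  Annihilators of monomials can thus be computed on exponents.\<close>

lemma keys_mult_monomial:
  fixes p :: "'m::cancel_comm_monoid_add \<Rightarrow>\<^sub>0 'k::field"
  shows "Poly_Mapping.keys (p * monomial g) = (\<lambda>m. m + g) ` Poly_Mapping.keys p"
proof
  show "Poly_Mapping.keys (p * monomial g) \<subseteq> (\<lambda>m. m + g) ` Poly_Mapping.keys p"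
    using keys_mult[of p "monomial g"] by auto
  have "Poly_Mapping.lookup (p * monomial g) (m + g) = Poly_Mapping.lookup p m" for m
    by (simp add: lookup_mult_sum sum.cartesian_product[symmetric] when_def in_keys_iff)
  then show "(\<lambda>m. m + g) ` Poly_Mapping.keys p \<subseteq> Poly_Mapping.keys (p * monomial g)"
    by (auto simp: in_keys_iff)
qed

lemma colon_monomial_ideal:
  fixes g :: "'m::cancel_comm_monoid_add"
  shows "{r :: 'm \<Rightarrow>\<^sub>0 'k::field. r * monomial g \<in> monomial_ideal S} = monomial_ideal {m. m + g \<in> S}"
  by (auto simp: monomial_ideal_def keys_mult_monomial)


section \<open>Ideals generated by variables\<close>

text \<open>The complement consists of the monomials in variables outside \<open>F\<close>, the ones
  that become units on localizing at \<open>P_F\<close>.\<close>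

definition exps_meeting :: "'v set \<Rightarrow> ('v \<Rightarrow>\<^sub>0 nat) set" where
  "exps_meeting F = {m. \<exists>i\<in>F. Poly_Mapping.lookup m i \<noteq> 0}"

lemma not_exps_meeting: "m \<notin> exps_meeting F \<longleftrightarrow> (\<forall>i\<in>F. Poly_Mapping.lookup m i = 0)"
  by (simp add: exps_meeting_def)

lemma add_closed_exps_meeting: "add_closed (exps_meeting F)"
  by (auto simp: add_closed_def exps_meeting_def lookup_add)

lemma ex_add_iff_lookup_le:
  fixes m g :: "'v \<Rightarrow>\<^sub>0 nat"
  shows "(\<exists>k. m = g + k) \<longleftrightarrow> (\<forall>v. Poly_Mapping.lookup g v \<le> Poly_Mapping.lookup m v)"
proof
  assume "\<forall>v. Poly_Mapping.lookup g v \<le> Poly_Mapping.lookup m v"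
  then have "m = g + (m - g)"
    by (intro poly_mapping_eqI) (simp add: lookup_add lookup_minus)
  then show "\<exists>k. m = g + k" ..
qed (auto simp: lookup_add)

lemma variable_ideal_eq:
  "(variable_ideal F :: ('v, 'k::field) mpolynomial set) = monomial_ideal (exps_meeting F)"
proof -
  have "pvar ` F = (monomial ` (\<lambda>i. Poly_Mapping.single i 1) ` F :: ('v, 'k) mpolynomial set)"
    by (simp add: image_image pvar_def)
  moreover have "{g + k |g k. g \<in> (\<lambda>i. Poly_Mapping.single i (1::nat)) ` F} = exps_meeting F"
  proof -
    have "(\<exists>k. m = Poly_Mapping.single i 1 + k) \<longleftrightarrow> Poly_Mapping.lookup m i \<noteq> 0"
      for m :: "'v \<Rightarrow>\<^sub>0 nat" and i
      by (auto simp: ex_add_iff_lookup_le lookup_single when_def)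
    moreover have "{g + k |g k. g \<in> (\<lambda>i. Poly_Mapping.single i (1::nat)) ` F} =
        {m. \<exists>i\<in>F. \<exists>k. m = Poly_Mapping.single i 1 + k}"
      by blast
    ultimately show ?thesis by (simp add: exps_meeting_def)
  qed
  ultimately show ?thesis by (simp add: variable_ideal_def genideal_monomials)
qed

lemma variable_ideal_psubset:
  assumes "F' \<subset> F"
  shows "(variable_ideal F' :: ('v, 'k::field) mpolynomial set) \<subset> variable_ideal F"
proof -
  obtain i where i: "i \<in> F" "i \<notin> F'" using assms by blast
  let ?m = "Poly_Mapping.single i (1::nat)"
  have "?m \<in> exps_meeting F" "?m \<notin> exps_meeting F'"
    using i by (auto simp: exps_meeting_def lookup_single when_def)
  then have "(monomial ?m :: ('v, 'k) mpolynomial) \<in> variable_ideal F - variable_ideal F'"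
    by (simp add: variable_ideal_eq monomial_ideal_def)
  moreover have "(variable_ideal F' :: ('v, 'k) mpolynomial set) \<subseteq> variable_ideal F"
    using assms by (force simp: variable_ideal_eq monomial_ideal_def exps_meeting_def)
  ultimately show ?thesis by blast
qed

section \<open>Primality of the ideals generated by variables\<close>

lemma ex_additive_linorder:
  "\<exists>\<phi> :: ('v::finite \<Rightarrow>\<^sub>0 nat) \<Rightarrow> (nat \<Rightarrow>\<^sub>0 nat). inj \<phi> \<and> (\<forall>m k. \<phi> (m + k) = \<phi> m + \<phi> k)"
proof -
  obtain f :: "'v \<Rightarrow> nat" where f: "inj f"
    using finite_imp_inj_to_nat_seg[OF finite_UNIV] by auto
  \<comment> \<open>Vertices are relabelled by numbers, since
    \<open>nat \<Rightarrow>\<^sub>0 nat\<close> has a linear order compatible with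
    addition.\<close>
  define \<phi> where "\<phi> m = (\<Sum>i\<in>UNIV. Poly_Mapping.single (f i) (Poly_Mapping.lookup m i))"
    for m :: "'v \<Rightarrow>\<^sub>0 nat"
  have "Poly_Mapping.lookup (\<phi> m) (f i) = Poly_Mapping.lookup m i" for m i
    using f by (simp add: \<phi>_def lookup_sum lookup_single when_def inj_eq)
  then have "inj \<phi>"
    by (intro injI poly_mapping_eqI) metis
  moreover have "\<phi> (m + k) = \<phi> m + \<phi> k" for m k
    by (simp add: \<phi>_def lookup_add single_add sum.distrib)
  ultimately show ?thesis by blast
qed

text \<open>
  The product of the least monomials of \<open>p\<close> and \<open>q\<close> outside \<open>P\<^sub>F\<close> cannot cancel in \<open>p q\<close>. An order
  on the monomials is pulled back from \<open>nat \<Rightarrow>\<^sub>0 nat\<close>, since \<open>'v\<close> carries none.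
\<close>

lemma primeideal_variable_ideal:
  "primeideal (variable_ideal F) (mpoly_ring :: ('v::finite, 'k::field) mpolynomial ring)"
proof (rule primeidealI)
  let ?P = "variable_ideal F :: ('v, 'k) mpolynomial set"
  show "ideal ?P mpoly_ring"
    by (simp add: variable_ideal_eq ideal_monomial_ideal add_closed_exps_meeting)
  show "cring (mpoly_ring :: ('v, 'k) mpolynomial ring)" by (rule cring_from_type_algebra)
  have "(1 :: ('v, 'k) mpolynomial) \<notin> ?P"
    by (simp add: variable_ideal_eq monomial_ideal_def exps_meeting_def)
  then show "carrier mpoly_ring \<noteq> ?P" by auto
  fix p q :: "('v, 'k) mpolynomial"
  assume "p \<otimes>\<^bsub>mpoly_ring\<^esub> q \<in> ?P"
  then have pq: "p * q \<in> ?P" by simp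
  obtain \<phi> :: "('v \<Rightarrow>\<^sub>0 nat) \<Rightarrow> (nat \<Rightarrow>\<^sub>0 nat)"
    where inj: "inj \<phi>" and add: "\<And>m k. \<phi> (m + k) = \<phi> m + \<phi> k"
    using ex_additive_linorder by blast
  have least: "\<exists>m \<in> Poly_Mapping.keys r - exps_meeting F.
      \<forall>k \<in> Poly_Mapping.keys r - exps_meeting F. \<phi> m \<le> \<phi> k"
    if "r \<notin> ?P" for r :: "('v, 'k) mpolynomial"
  proof -
    let ?K = "Poly_Mapping.keys r - exps_meeting F"
    have K: "finite ?K" "?K \<noteq> {}"
      using that by (auto simp: variable_ideal_eq monomial_ideal_def)
    show ?thesis
      using arg_min_if_finite(1)[OF K, of \<phi>] arg_min_least[OF K, of _ \<phi>] by blast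
  qed
  show "p \<in> ?P \<or> q \<in> ?P"
  proof (rule ccontr)
    assume "\<not> (p \<in> ?P \<or> q \<in> ?P)"
    then obtain m n where
      m: "m \<in> Poly_Mapping.keys p" "m \<notin> exps_meeting F"
        "\<And>k. k \<in> Poly_Mapping.keys p - exps_meeting F \<Longrightarrow> \<phi> m \<le> \<phi> k" and
      n: "n \<in> Poly_Mapping.keys q" "n \<notin> exps_meeting F"
        "\<And>k. k \<in> Poly_Mapping.keys q - exps_meeting F \<Longrightarrow> \<phi> n \<le> \<phi> k"
      using least[of p] least[of q] by blast
    have mn: "m + n \<notin> exps_meeting F"
      using m(2) n(2) by (simp add: not_exps_meeting lookup_add)
    \<comment> \<open>Both exponents of a contributing pair avoid \<open>F\<close>, so they are at
      least \<open>m\<close> and \<open>n\<close> in the order; equality of the sums forces equality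
      of each.\<close>
    have unique: "a = m \<and> b = n"
      if "a \<in> Poly_Mapping.keys p" "b \<in> Poly_Mapping.keys q" "a + b = m + n" for a b
    proof -
      have "a + b \<notin> exps_meeting F" using mn that(3) by simp
      then have "a \<notin> exps_meeting F" "b \<notin> exps_meeting F"
        by (simp_all add: not_exps_meeting lookup_add)
      then have "\<phi> m \<le> \<phi> a" "\<phi> n \<le> \<phi> b" using m(3) n(3) that by auto
      moreover have "\<phi> a + \<phi> b = \<phi> m + \<phi> n" using that(3) add by metis
      ultimately have "\<phi> a = \<phi> m" "\<phi> b = \<phi> n"
        by (metis add_le_cancel_left add_le_cancel_right add_mono antisym order_refl)+
      then show ?thesis using inj by (simp add: inj_eq)
    qed
    have "Poly_Mapping.lookup (p * q) (m + n) =
        (\<Sum>(a, b)\<in>{(m, n)}. (Poly_Mapping.lookup p a * Poly_Mapping.lookup q b when a + b = m + n))"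
      unfolding lookup_mult_sum
    proof (rule sum.mono_neutral_right)
      show "\<forall>x\<in>Poly_Mapping.keys p \<times> Poly_Mapping.keys q - {(m, n)}.
          (case x of (a, b) \<Rightarrow> Poly_Mapping.lookup p a * Poly_Mapping.lookup q b when a + b = m + n) = 0"
        using unique by (auto simp only: when_def split: if_splits)
    qed (use m(1) n(1) in auto)
    also have "\<dots> \<noteq> 0" using m(1) n(1) by (simp add: in_keys_iff)
    finally have "m + n \<in> Poly_Mapping.keys (p * q)" by (simp add: in_keys_iff)
    then show False using pq mn by (auto simp: variable_ideal_eq monomial_ideal_def)
  qed
qed

section \<open>A criterion for associated primes by localized annihilators\<close>

text \<open>
  The first two hypotheses say that, after inverting the variables outside \<open>F\<close>, the annihilator of
  \<open>x\<^sup>b\<close> is proper and contains a power of every variable of \<open>F\<close>. Multiplying \<open>x\<^sup>b\<close> by a monomial of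
  maximal degree that keeps it outside the localized ideal, the annihilator becomes \<open>P\<^sub>F\<close>.
\<close>

lemma associated_prime_variable_ideal:
  fixes S :: "('v::finite \<Rightarrow>\<^sub>0 nat) set"
  assumes proper: "\<And>c. c \<notin> exps_meeting F \<Longrightarrow> b + c \<notin> S"
    and power: "\<And>i. i \<in> F \<Longrightarrow> \<exists>n c. c \<notin> exps_meeting F \<and> b + (Poly_Mapping.single i n + c) \<in> S"
    and S: "add_closed S"
  shows "associated_prime mpoly_ring (monomial_ideal S :: ('v, 'k::field) mpolynomial set)
    (variable_ideal F)"
proof -
  have up: "m \<in> S \<Longrightarrow> m + k \<in> S" for m k
    using S by (auto simp: add_closed_def)
  \<comment> \<open>Monomials in the variables of \<open>F\<close> whose product with
    \<open>x^b\<close> stays outside the localized ideal; \<open>c\<close> ranges over the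
    units.\<close>
  define H where "H = {h. h \<notin> exps_meeting (- F) \<and> (\<forall>c. c \<notin> exps_meeting F \<longrightarrow> b + h + c \<notin> S)}"
  define deg where "deg h = (\<Sum>i\<in>UNIV. Poly_Mapping.lookup h i)" for h :: "'v \<Rightarrow>\<^sub>0 nat"
  obtain n where n: "\<And>i. i \<in> F \<Longrightarrow> \<exists>c. c \<notin> exps_meeting F \<and> b + (Poly_Mapping.single i (n i) + c) \<in> S"
    using power by metis
  \<comment> \<open>A larger exponent would make \<open>h\<close> divisible by the power of
    \<open>x_i\<close> that moves \<open>x^b\<close> into the localized ideal. Hence degrees in
    \<open>H\<close> are bounded.\<close>
  have bound: "Poly_Mapping.lookup h i \<le> (if i \<in> F then n i else 0)" if "h \<in> H" for h i
  proof (cases "i \<in> F")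
    case True
    show ?thesis
    proof (rule ccontr)
      assume "\<not> ?thesis"
      then have "\<exists>k. h = Poly_Mapping.single i (n i) + k"
        using True by (auto simp: ex_add_iff_lookup_le lookup_single when_def)
      then obtain k where k: "h = Poly_Mapping.single i (n i) + k" ..
      obtain c where c: "c \<notin> exps_meeting F" "b + (Poly_Mapping.single i (n i) + c) \<in> S"
        using n True by blast
      from up[OF c(2), of k] have "b + h + c \<in> S" by (simp add: k ac_simps)
      with that c(1) show False by (simp add: H_def)
    qed
  qed (use that in \<open>simp add: H_def not_exps_meeting\<close>)
  have "deg h \<le> (\<Sum>i\<in>UNIV. if i \<in> F then n i else 0)" if "h \<in> H" for h
    unfolding deg_def using bound[OF that] by (intro sum_mono)
  moreover have "0 \<in> H" using proper by (simp add: H_def not_exps_meeting)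
  ultimately obtain h where h: "h \<in> H" and max: "\<And>k. k \<in> H \<Longrightarrow> deg k \<le> deg h"
    using ex_has_greatest_nat[of "\<lambda>h. h \<in> H" 0 deg "Suc (\<Sum>i\<in>UNIV. if i \<in> F then n i else 0)"]
    by (metis le_imp_less_Suc)
  \<comment> \<open>By maximality of \<open>h\<close>, one more factor \<open>x_i\<close> enters the
    localized ideal; \<open>c\<close> clears the denominator.\<close>
  have "\<exists>c. c \<notin> exps_meeting F \<and> b + (h + Poly_Mapping.single i 1) + c \<in> S" if i: "i \<in> F" for i
  proof (rule ccontr)
    assume neg: "\<not> ?thesis"
    have "h + Poly_Mapping.single i 1 \<notin> exps_meeting (- F)"
      using h i by (auto simp: H_def not_exps_meeting lookup_add lookup_single when_def)
    then have "h + Poly_Mapping.single i 1 \<in> H"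
      using neg by (auto simp: H_def)
    moreover have "deg (h + Poly_Mapping.single i 1) = Suc (deg h)"
      by (simp add: deg_def lookup_add lookup_single sum.distrib when_def)
    ultimately show False using max by fastforce
  qed
  then obtain c where c: "\<And>i. i \<in> F \<Longrightarrow> c i \<notin> exps_meeting F"
    "\<And>i. i \<in> F \<Longrightarrow> b + (h + Poly_Mapping.single i 1) + c i \<in> S"
    by metis
  \<comment> \<open>The product of all the denominators serves every \<open>i\<close> in
    \<open>F\<close> at once and is still a unit in the localization.\<close>
  define g where "g = b + h + (\<Sum>i\<in>F. c i)"
  have "(\<Sum>i\<in>F. c i) \<notin> exps_meeting F"
    using c(1) by (simp add: not_exps_meeting lookup_sum)
  then have "m + g \<notin> S" if "m \<notin> exps_meeting F" for m
  proof -
    have "m + (\<Sum>i\<in>F. c i) \<notin> exps_meeting F"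
      using that \<open>(\<Sum>i\<in>F. c i) \<notin> exps_meeting F\<close> by (simp add: not_exps_meeting lookup_add)
    then have "b + h + (m + (\<Sum>i\<in>F. c i)) \<notin> S" using h by (simp add: H_def)
    then show ?thesis by (simp add: g_def ac_simps)
  qed
  moreover have "m + g \<in> S" if "m \<in> exps_meeting F" for m
  proof -
    obtain i where i: "i \<in> F" "Poly_Mapping.lookup m i \<noteq> 0"
      using \<open>m \<in> exps_meeting F\<close> by (auto simp: exps_meeting_def)
    then have "\<exists>k. m = Poly_Mapping.single i 1 + k"
      by (auto simp: ex_add_iff_lookup_le lookup_single when_def)
    then obtain k where k: "m = Poly_Mapping.single i 1 + k" ..
    have "(\<Sum>i\<in>F. c i) = c i + (\<Sum>i\<in>F - {i}. c i)"
      using i by (simp add: sum.remove)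
    then show ?thesis
      using up[OF c(2)[OF i(1)], of "k + (\<Sum>i\<in>F - {i}. c i)"] by (simp add: g_def k ac_simps)
  qed
  ultimately have "{m. m + g \<in> S} = exps_meeting F" by blast
  then have "variable_ideal F = {r \<in> carrier mpoly_ring.
      r \<otimes>\<^bsub>mpoly_ring\<^esub> (monomial g :: ('v, 'k) mpolynomial) \<in> monomial_ideal S}"
    by (simp add: colon_monomial_ideal variable_ideal_eq)
  moreover have "(monomial g :: ('v, 'k) mpolynomial) \<in> carrier mpoly_ring" by simp
  ultimately show ?thesis
    unfolding associated_prime_def using primeideal_variable_ideal by blast
qed


section \<open>Powers of edge ideals\<close>

definition edge_exp :: "'v set \<Rightarrow> ('v \<Rightarrow>\<^sub>0 nat)" where
  "edge_exp e = (\<Sum>v\<in>e. Poly_Mapping.single v 1)"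

text \<open>Multisets allow repeated edges in a product of generators, as in
  \<open>wmatching\<close>.\<close>

definition edge_exps :: "'v set set \<Rightarrow> nat \<Rightarrow> ('v \<Rightarrow>\<^sub>0 nat) set" where
  "edge_exps E t = {(\<Sum>e\<in>#M. edge_exp e) + k |M k. set_mset M \<subseteq> E \<and> size M = t}"

lemma edge_exps_0: "edge_exps E 0 = UNIV"
  by (auto simp: edge_exps_def)

lemma add_closed_edge_exps: "add_closed (edge_exps E t)"
  by (fastforce simp: add_closed_def edge_exps_def add.assoc)

text \<open>Splitting off one edge gives the shape produced by \<open>ideal_prod_monomial\<close>,
  for the induction on the power.\<close>

lemma edge_exps_Suc:
  "edge_exps E (Suc t) = {s + u |s u. s \<in> edge_exps E t \<and> u \<in> {g + k |g k. g \<in> edge_exp ` E}}"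
    (is "_ = ?R")
proof
  show "edge_exps E (Suc t) \<subseteq> ?R"
  proof
    fix m assume "m \<in> edge_exps E (Suc t)"
    then obtain M k where M: "m = (\<Sum>e\<in>#M. edge_exp e) + k" "set_mset M \<subseteq> E" "size M = Suc t"
      by (auto simp: edge_exps_def)
    then obtain e N where N: "M = add_mset e N" by (metis size_eq_Suc_imp_eq_union)
    have "(\<Sum>e\<in>#N. edge_exp e) \<in> edge_exps E t"
      unfolding edge_exps_def using M N by (intro CollectI exI[of _ N] exI[of _ 0]) auto
    moreover have "m = (\<Sum>e\<in>#N. edge_exp e) + (edge_exp e + k)"
      by (simp add: M N ac_simps)
    ultimately show "m \<in> ?R" using M N by auto
  qed
  show "?R \<subseteq> edge_exps E (Suc t)"
  proof
    fix m assume "m \<in> ?R"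
    then obtain M k e l where "m = ((\<Sum>e\<in>#M. edge_exp e) + k) + (edge_exp e + l)"
      "set_mset M \<subseteq> E" "size M = t" "e \<in> E"
      by (auto simp: edge_exps_def)
    then have "m = (\<Sum>e\<in>#add_mset e M. edge_exp e) + (k + l)"
      "set_mset (add_mset e M) \<subseteq> E" "size (add_mset e M) = Suc t"
      by (simp_all add: ac_simps)
    then show "m \<in> edge_exps E (Suc t)" unfolding edge_exps_def by blast
  qed
qed

lemma edge_exps_antimono: "s \<le> t \<Longrightarrow> edge_exps E t \<subseteq> edge_exps E s"
proof (rule lift_Suc_antimono_le)
  show "edge_exps E (Suc n) \<subseteq> edge_exps E n" for n
    using add_closed_edge_exps[of E n] by (auto simp: edge_exps_Suc add_closed_def)
qed

lemma edge_ideal_eq: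
  assumes "simple_graph E"
  shows "(edge_ideal E :: ('v, 'k::field) mpolynomial set) =
    monomial_ideal {g + k |g k. g \<in> edge_exp ` E}"
proof -
  have pair: "pvar i * pvar j = (monomial (edge_exp {i, j}) :: ('v, 'k) mpolynomial)"
    if "{i, j} \<in> E" for i j
  proof -
    \<comment> \<open>If \<open>i = j\<close>, the set \<open>{i, j}\<close> would record exponent
      1, while the product is a square.\<close>
    have "i \<noteq> j" using assms that by (auto simp: simple_graph_def)
    then show ?thesis by (simp add: pvar_def mult_single edge_exp_def)
  qed
  have "{pvar i * pvar j |i j. {i, j} \<in> E} = (monomial ` edge_exp ` E :: ('v, 'k) mpolynomial set)"
    (is "?A = ?B")
  proof
    show "?A \<subseteq> ?B"
    proof clarify
      fix i j assume "{i, j} \<in> E"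
      then show "pvar i * pvar j \<in> ?B" by (simp add: pair)
    qed
    show "?B \<subseteq> ?A"
    proof clarify
      fix e assume e: "e \<in> E"
      then obtain i j where "e = {i, j}" using assms by (auto simp: simple_graph_def card_2_iff)
      then have "monomial (edge_exp e) = (pvar i * pvar j :: ('v, 'k) mpolynomial)" "{i, j} \<in> E"
        using e by (simp_all add: pair)
      then show "\<exists>i j. monomial (edge_exp e) = (pvar i * pvar j :: ('v, 'k) mpolynomial) \<and> {i, j} \<in> E"
        by blast
    qed
  qed
  then show ?thesis by (simp add: edge_ideal_def genideal_monomials)
qed

lemma ideal_power_edge_ideal:
  assumes "simple_graph E"
  shows "ideal_power mpoly_ring (edge_ideal E :: ('v, 'k::field) mpolynomial set) t =
    monomial_ideal (edge_exps E t)"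
proof (induction t)
  case 0
  show ?case
    \<comment> \<open>The zeroth power is the whole ring, the unit of the monoid of ideals.\<close>
    by (auto simp: ideal_power_def nat_pow_def ideals_set_def edge_exps_0 monomial_ideal_def)
next
  case (Suc t)
  then show ?case
    using assms
    by (simp add: ideal_power_def nat_pow_def ideals_set_def edge_ideal_eq ideal_prod_monomial
        edge_exps_Suc)
qed

section \<open>Membership in powers as a matching condition\<close>

lemma lookup_sum_edge_exp:
  fixes M :: "'v::finite set multiset"
  shows "Poly_Mapping.lookup (\<Sum>e\<in>#M. edge_exp e) v = size {#e \<in># M. v \<in> e#}"
  by (induction M) (simp_all add: lookup_add edge_exp_def lookup_sum lookup_single when_def)

text \<open>Divisibility by a product of edges is the matching inequality at every vertex, with
  exponents as weights.\<close>

lemma edge_exps_iff: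
  fixes E :: "'v::finite set set"
  shows "m \<in> edge_exps E t \<longleftrightarrow> (\<exists>M. set_mset M \<subseteq> E \<and> size M = t \<and>
    (\<forall>v. size {#e \<in># M. v \<in> e#} \<le> Poly_Mapping.lookup m v))"
proof -
  have "m \<in> edge_exps E t \<longleftrightarrow>
      (\<exists>M. set_mset M \<subseteq> E \<and> size M = t \<and> (\<exists>k. m = (\<Sum>e\<in>#M. edge_exp e) + k))"
    by (auto simp: edge_exps_def)
  then show ?thesis by (simp add: ex_add_iff_lookup_le lookup_sum_edge_exp)
qed

lemma edge_expsI:
  fixes E :: "'v::finite set set"
  assumes "set_mset M \<subseteq> E" "t \<le> size M"
    and "\<And>v. size {#e \<in># M. v \<in> e#} \<le> Poly_Mapping.lookup m v"
  shows "m \<in> edge_exps E t"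
proof -
  have "m \<in> edge_exps E (size M)" using assms(1,3) by (auto simp: edge_exps_iff)
  then show ?thesis using edge_exps_antimono[OF assms(2)] by blast
qed


section \<open>Covers and saturating weights\<close>

lemma simple_graph_other_end:
  assumes "simple_graph E" "e \<in> E" "i \<in> e"
  obtains v where "e = {i, v}" "v \<noteq> i"
proof -
  have "card e = 2" using assms by (simp add: simple_graph_def)
  then obtain x y where "e = {x, y}" "x \<noteq> y" by (auto simp: card_2_iff)
  with assms(3) that show ?thesis by (metis insert_commute insertE singletonD)
qed

lemma filter_replicate_mset:
  "filter_mset P (replicate_mset n x) = (if P x then replicate_mset n x else {#})"
  by (induction n) auto

lemma wmatching_size_le:
  assumes "weighted_graph W" "wmatching W M"
  shows "size M \<le> matching_number W"
  unfolding matching_number_def using wmatching_sizes[OF assms(1)] assms(2) by (intro Max_ge) auto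

lemma ex_maximum_wmatching:
  assumes "weighted_graph W"
  shows "\<exists>M. wmatching W M \<and> size M = matching_number W"
  using Max_in[OF wmatching_sizes[OF assms]] by (auto simp: matching_number_def)

lemma incident_pos: "e \<in># M \<Longrightarrow> v \<in> e \<Longrightarrow> size {#e \<in># M. v \<in> e#} > 0"
  by (metis (mono_tags, lifting) filter_mset_eq_mempty_iff gr0I size_eq_0_iff_empty)

text \<open>An edge uncovered by removing \<open>i\<close> joins it to some \<open>v\<close> outside
  \<open>F\<close>. The \<open>t\<close>-th power of \<open>x_i x_v\<close> lies in the edge ideal
  power, and \<open>x_v\<close> is a unit after localizing.\<close>

lemma edge_exps_private_neighbour:
  fixes E :: "'v::finite set set"
  assumes "simple_graph E" "graph_cover E F" "\<not> graph_cover E (F - {i})"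
  shows "\<exists>n c. c \<notin> exps_meeting F \<and> b + (Poly_Mapping.single i n + c) \<in> edge_exps E t"
proof -
  obtain e where e: "e \<in> E" "e \<inter> (F - {i}) = {}" using assms(3) by (auto simp: graph_cover_def)
  then have "i \<in> e" "i \<in> F" using assms(2) by (auto simp: graph_cover_def)
  from simple_graph_other_end[OF assms(1) e(1) this(1)]
  obtain v where v: "e = {i, v}" "v \<noteq> i" .
  with e have "v \<notin> F" by auto
  have "b + (Poly_Mapping.single i t + Poly_Mapping.single v t) \<in> edge_exps E t"
    using e(1) v by (intro edge_expsI[of "replicate_mset t e"])
      (auto simp: lookup_add lookup_single filter_replicate_mset)
  moreover have "Poly_Mapping.single v t \<notin> exps_meeting F"
    using \<open>v \<notin> F\<close> by (auto simp: not_exps_meeting lookup_single when_def)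
  ultimately show ?thesis by blast
qed

text \<open>A maximum matching avoiding \<open>j\<close> leaves all \<open>a j\<close> copies of
  \<open>x_j\<close> free. They pair with the new copies of \<open>x_i\<close>, adding
  \<open>a j\<close> edges.\<close>

lemma edge_exps_saturating:
  fixes E :: "'v::finite set set" and b :: "'v \<Rightarrow>\<^sub>0 nat"
  defines "a \<equiv> Poly_Mapping.lookup b"
  assumes "simple_graph E" "strongly_saturating t (induced_wgraph E a)"
    and j: "j \<in> vec_support a" "{i, j} \<in> E"
  shows "b + Poly_Mapping.single i (a j) \<in> edge_exps E t"
proof -
  let ?W = "induced_wgraph E a"
  have "i \<noteq> j" using assms by (auto simp: simple_graph_def)
  obtain M where M: "wmatching (delete_vertex ?W j) M" "size M = matching_number (delete_vertex ?W j)"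
    using ex_maximum_wmatching[OF weighted_graph_delete[OF weighted_graph_induced]] assms(2) by blast
  have size: "t \<le> size M + a j"
    using assms(3) j(1) M(2) by (fastforce simp: strongly_saturating_def induced_wgraph_def)
  have M_edges: "e \<in> E" "e \<subseteq> vec_support a - {j}" if "e \<in># M" for e
    using M(1) that by (auto simp: wmatching_def delete_vertex_def induced_wgraph_def)
  \<comment> \<open>Nothing is used at \<open>j\<close>, nor outside the support.\<close>
  have M_le: "size {#e \<in># M. v \<in> e#} \<le> (if v = j then 0 else a v)" for v
  proof (cases "v \<in> vec_support a - {j}")
    case True
    then show ?thesis using M(1) by (simp add: wmatching_def delete_vertex_def induced_wgraph_def)
  next
    case False
    then have "size {#e \<in># M. v \<in> e#} = 0" using M_edges by auto
    then show ?thesis by linarith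
  qed
  show ?thesis
  proof (rule edge_expsI[of "M + replicate_mset (a j) {i, j}"])
    show "size {#e \<in># M + replicate_mset (a j) {i, j}. v \<in> e#}
        \<le> Poly_Mapping.lookup (b + Poly_Mapping.single i (a j)) v" for v
      using M_le[of v] \<open>i \<noteq> j\<close>
      by (auto simp: lookup_add lookup_single filter_replicate_mset a_def[symmetric] when_def)
  qed (use M_edges j(2) size in auto)
qed

text \<open>Since \<open>c\<close> vanishes on \<open>F\<close>, an edge of the product can meet
  \<open>F\<close> only in the support of \<open>a\<close>. It does meet \<open>F\<close>, so its
  other end lies in the closed neighbourhood, hence in \<open>F\<close> and in the support
  too.\<close>

lemma edge_exps_not_saturating:
  fixes E :: "'v::finite set set" and b :: "'v \<Rightarrow>\<^sub>0 nat"
  defines "a \<equiv> Poly_Mapping.lookup b"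
  assumes "simple_graph E" "matching_number (induced_wgraph E a) < t"
    and "graph_cover E F" "closed_nbhd E (vec_support a) \<subseteq> F" "c \<notin> exps_meeting F"
  shows "b + c \<notin> edge_exps E t"
proof
  let ?W = "induced_wgraph E a"
  assume "b + c \<in> edge_exps E t"
  then obtain M where M: "set_mset M \<subseteq> E" "size M = t"
    "\<And>v. size {#e \<in># M. v \<in> e#} \<le> a v + Poly_Mapping.lookup c v"
    by (auto simp: edge_exps_iff lookup_add a_def)
  have c: "Poly_Mapping.lookup c v = 0" if "v \<in> F" for v
    using assms(6) that by (simp add: not_exps_meeting)
  have U: "v \<in> vec_support a" if "e \<in># M" "v \<in> e" "v \<in> F" for e v
    using incident_pos[OF that(1,2)] M(3)[of v] c[OF that(3)] by (simp add: vec_support_def)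
  have "e \<subseteq> vec_support a" if e: "e \<in># M" for e
  proof
    fix w assume w: "w \<in> e"
    have "e \<in> E" using e M(1) by blast
    then obtain v where v: "v \<in> e" "v \<in> F" using assms(4) by (auto simp: graph_cover_def)
    have "w \<in> F"
    proof (cases "w = v")
      case False
      then have "e = {v, w}"
        using simple_graph_other_end[OF assms(2) \<open>e \<in> E\<close> v(1)] w by blast
      then have "w \<in> closed_nbhd E (vec_support a)"
        using U[OF e v] \<open>e \<in> E\<close> by (auto simp: closed_nbhd_def)
      then show ?thesis using assms(5) by blast
    qed (use v in simp)
    then show "w \<in> vec_support a" using U e w by blast
  qed
  moreover have "size {#e \<in># M. v \<in> e#} \<le> a v" if "v \<in> vec_support a" for v
    using M(3)[of v] c[of v] that assms(5) by (auto simp: closed_nbhd_def)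
  ultimately have "wmatching ?W M"
    using M(1) by (auto simp: wmatching_def induced_wgraph_def)
  then have "t \<le> matching_number ?W"
    using wmatching_size_le[OF weighted_graph_induced] assms(2) M(2) by blast
  then show False using assms(3) by simp
qed

lemma ex_minimal_cover:
  fixes C :: "'v::finite set"
  assumes "graph_cover E C"
  shows "\<exists>F\<subseteq>C. graph_cover E F \<and> (\<forall>i\<in>F. \<not> graph_cover E (F - {i}))"
proof -
  obtain F where F: "F \<subseteq> C" "graph_cover E F" "\<And>F'. graph_cover E F' \<Longrightarrow> F' \<subseteq> F \<Longrightarrow> F' = F"
    using finite_has_minimal2[of "{F. graph_cover E F}" C] assms by auto
  then show ?thesis by blast
qed

theorem theorem3p3:
  fixes E :: "'v::finite set set" and U F :: "'v set" and t :: nat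
  assumes "simple_graph E"
    and "t \<ge> 2"
    and "\<exists>a :: 'v \<Rightarrow> nat. vec_support a = U \<and> strongly_saturating t (induced_wgraph E a)"
    and "U \<noteq> {}"
    and "\<forall>i\<in>U. \<exists>j\<in>U. {i, j} \<in> E"
    and "minimal_cover_containing E (closed_nbhd E U) F"
  shows "embedded_associated_prime (mpoly_ring :: ('v, 'k::field) mpolynomial ring)
           (ideal_power mpoly_ring (edge_ideal E) t) (variable_ideal F)"
proof -
  let ?It = "monomial_ideal (edge_exps E t) :: ('v, 'k) mpolynomial set"
  obtain a where a: "vec_support a = U" "strongly_saturating t (induced_wgraph E a)"
    using assms(3) by blast
  define b where "b = Poly_Mapping.Abs_poly_mapping a"
  have b: "Poly_Mapping.lookup b = a" by (simp add: b_def)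
  have F: "graph_cover E F" "closed_nbhd E U \<subseteq> F"
    and min: "\<And>F'. F' \<subset> F \<Longrightarrow> closed_nbhd E U \<subseteq> F' \<Longrightarrow> \<not> graph_cover E F'"
    using assms(6) by (auto simp: minimal_cover_containing_def)
  have "associated_prime mpoly_ring ?It (variable_ideal F)"
  proof (rule associated_prime_variable_ideal[OF _ _ add_closed_edge_exps])
    show "b + c \<notin> edge_exps E t" if "c \<notin> exps_meeting F" for c
      using edge_exps_not_saturating[of E b t F c] assms(1) a F that
      by (simp add: b strongly_saturating_def)
    fix i assume i: "i \<in> F"
    show "\<exists>n c. c \<notin> exps_meeting F \<and> b + (Poly_Mapping.single i n + c) \<in> edge_exps E t"
    proof (cases "i \<in> closed_nbhd E U")
      case True
      \<comment> \<open>Even a vertex of \<open>U\<close> itself has a neighbour in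
        \<open>U\<close>, as there are no isolated vertices.\<close>
      then obtain j where "j \<in> U" "{i, j} \<in> E"
        using assms(5) by (auto simp: closed_nbhd_def insert_commute)
      then have "b + Poly_Mapping.single i (a j) \<in> edge_exps E t"
        using edge_exps_saturating[of E t b j i] assms(1) a by (simp add: b)
      then show ?thesis
        by (intro exI[of _ "a j"] exI[of _ 0]) (simp add: not_exps_meeting)
    next
      case False
      \<comment> \<open>Removing \<open>i\<close> keeps the closed neighbourhood inside, so
        minimality of \<open>F\<close> applies.\<close>
      then have "\<not> graph_cover E (F - {i})" using i F(2) by (intro min) auto
      then show ?thesis using edge_exps_private_neighbour assms(1) F(1) by blast
    qed
  qed
  moreover obtain F' where "associated_prime mpoly_ring ?It (variable_ideal F')" "F' \<subset> F"
  proof -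
    obtain i where i: "i \<in> U" using assms(4) by blast
    \<comment> \<open>All neighbours of \<open>i\<close> lie in \<open>F\<close>, so
      \<open>i\<close> is redundant in the cover.\<close>
    have "e \<inter> (F - {i}) \<noteq> {}" if e: "e \<in> E" for e
    proof (cases "i \<in> e")
      case True
      then obtain v where v: "e = {i, v}" "v \<noteq> i"
        using simple_graph_other_end[OF assms(1) e] by blast
      then have "v \<in> closed_nbhd E U" using e i by (auto simp: closed_nbhd_def)
      then show ?thesis using v F(2) by blast
    qed (use e F(1) in \<open>auto simp: graph_cover_def\<close>)
    then have "graph_cover E (F - {i})" by (simp add: graph_cover_def)
    then obtain F' where F': "F' \<subseteq> F - {i}" "graph_cover E F'"
      "\<And>i. i \<in> F' \<Longrightarrow> \<not> graph_cover E (F' - {i})"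
      using ex_minimal_cover by metis
    have "associated_prime mpoly_ring ?It (variable_ideal F')"
    proof (rule associated_prime_variable_ideal[OF _ _ add_closed_edge_exps])
      fix c assume c: "c \<notin> exps_meeting F'"
      show "0 + c \<notin> edge_exps E t"
      proof
        assume "0 + c \<in> edge_exps E t"
        then obtain M where M: "set_mset M \<subseteq> E" "size M = t"
          "\<And>v. size {#e \<in># M. v \<in> e#} \<le> Poly_Mapping.lookup c v"
          by (auto simp: edge_exps_iff)
        \<comment> \<open>As \<open>t\<close> is positive, the product contains an edge; it meets
          \<open>F'\<close>, where \<open>c\<close> is zero.\<close>
        then obtain e where e: "e \<in># M" using assms(2) by fastforce
        then obtain v where v: "v \<in> e" "v \<in> F'" using M(1) F'(2) by (auto simp: graph_cover_def)
        then have "Poly_Mapping.lookup c v = 0" using c by (simp add: not_exps_meeting)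
        then show False
          using incident_pos[OF e v(1)] M(3)[of v] by linarith
      qed
    qed (use edge_exps_private_neighbour assms(1) F' in blast)
    moreover have "F' \<subset> F" using F'(1) F(2) i by (auto simp: closed_nbhd_def)
    ultimately show thesis by (rule that)
  qed
  ultimately show ?thesis
    unfolding embedded_associated_prime_def ideal_power_edge_ideal[OF assms(1)]
    by (intro conjI exI[of _ "variable_ideal F'"] variable_ideal_psubset)
qed

end
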